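(* Suppose that $\kappa$ is an uncountable regular cardinal and that $c:[2^\kappa]^2\to\kappa$ is almost $\Delta$-regressive and Borel. Then there are $c$-monochromatic sets of size $\kappa$.
   Context: $2^\kappa$ denotes the set of all functions from $\kappa$ to $2=\{0,1\}$; $[X]^2$ is the set of two-element subsets of $X$, and $c(x,y)$ abbreviates $c(\{x,y\})$. For distinct $x,y\in 2^\kappa$, $\Delta(x,y)=\min\{i<\kappa: x(i)\neq y(i)\}$. A colouring $c:[2^\kappa]^2\to\kappa$ is almost $\Delta$-regressive if there is an ordinal $\mu<\kappa$ such that $c(x,y)<\max\{\Delta(x,y),\mu\}$ for all $x\neq y$ in $2^\kappa$. A set $Y\subseteq 2^\kappa$ is $c$-monochromatic if $c\restriction[Y]^2$ is constant. Topology: $2^\kappa$ carries the ${<}\kappa$-supported product topology, whose basic open sets are $N_s=\{x\in 2^\kappa\mid s\subseteq x\}$ for $s\in 2^{<\kappa}=\bigcup_{\alpha<\kappa}2^\alpha$; $[2^\kappa]^2$ inherits the subspace topology from the product space $2^\kappa\times 2^\kappa$ (viewing colourings of pairs as symmetric functions on $\{(x,y): x\neq y\}$); $\kappa$ has the discrete topology. "Borel" means $\kappa$-Borel: the Borel sets of a space form the smallest collection of sets containing the open sets and closed under complements and under unions and intersections of size $\kappa$. A colouring $c$ is Borel if preimages of open sets are Borel; equivalently, for each $i<\kappa$ the set $\{(x,y): x\neq y,\ c(x,y)=i\}$ is Borel in $2^\kappa\times 2^\kappa$. *)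

theory Defs
  imports "HOL-Analysis.Analysis" "HOL-Library.Ramsey"
begin

unbundle cardinal_syntax

text \<open>
  A cardinal is a cardinal order \<open>\<kappa> :: 'a rel\<close>.  Its field plays the role of the
  set of ordinals below \<open>\<kappa>\<close>: an element \<open>a\<close> stands for the order type of
  \<open>underS \<kappa> a\<close>, and \<open>underS \<kappa> a\<close> itself is that ordinal viewed as the set of its
  predecessors.  The strict order is \<open>\<kappa> - Id\<close>.
\<close>

definition cantor :: "'a rel \<Rightarrow> ('a \<Rightarrow> bool) set"
  where "cantor \<kappa> = Field \<kappa> \<rightarrow>\<^sub>E UNIV"

definition cone :: "'a rel \<Rightarrow> 'a \<Rightarrow> ('a \<Rightarrow> bool) \<Rightarrow> ('a \<Rightarrow> bool) set"
  where "cone \<kappa> \<alpha> s = {x \<in> cantor \<kappa>. \<forall>i \<in> underS \<kappa> \<alpha>. x i = s i}"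

definition cantor_topology :: "'a rel \<Rightarrow> ('a \<Rightarrow> bool) topology"
  where "cantor_topology \<kappa> = topology_generated_by
    {cone \<kappa> \<alpha> s | \<alpha> s. \<alpha> \<in> Field \<kappa> \<and> s \<in> underS \<kappa> \<alpha> \<rightarrow>\<^sub>E UNIV}"

definition pair_topology :: "'a rel \<Rightarrow> (('a \<Rightarrow> bool) \<times> ('a \<Rightarrow> bool)) topology"
  where "pair_topology \<kappa> =
    subtopology (prod_topology (cantor_topology \<kappa>) (cantor_topology \<kappa>)) {(x, y). x \<noteq> y}"

text \<open>Indexing by \<open>Field \<kappa>\<close> with repetitions allowed gives all nonempty families of size at most \<open>\<kappa>\<close>.\<close>

inductive_set kborel :: "'a rel \<Rightarrow> 'b topology \<Rightarrow> 'b set set"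
  for \<kappa> :: "'a rel" and X :: "'b topology"
  where
    kborel_open: "openin X U \<Longrightarrow> U \<in> kborel \<kappa> X"
  | kborel_compl: "A \<in> kborel \<kappa> X \<Longrightarrow> topspace X - A \<in> kborel \<kappa> X"
  | kborel_Union: "(\<And>i. i \<in> Field \<kappa> \<Longrightarrow> F i \<in> kborel \<kappa> X) \<Longrightarrow> (\<Union>i\<in>Field \<kappa>. F i) \<in> kborel \<kappa> X"
  | kborel_Inter: "Field \<kappa> \<noteq> {} \<Longrightarrow> (\<And>i. i \<in> Field \<kappa> \<Longrightarrow> F i \<in> kborel \<kappa> X) \<Longrightarrow>
      (\<Inter>i\<in>Field \<kappa>. F i) \<in> kborel \<kappa> X"

definition borel_colouring :: "'a rel \<Rightarrow> (('a \<Rightarrow> bool) set \<Rightarrow> 'a) \<Rightarrow> bool"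
  where "borel_colouring \<kappa> c \<longleftrightarrow>
    (\<forall>U. openin (discrete_topology (Field \<kappa>)) U \<longrightarrow>
      {(x, y) \<in> topspace (pair_topology \<kappa>). c {x, y} \<in> U} \<in> kborel \<kappa> (pair_topology \<kappa>))"

definition splitting :: "'a rel \<Rightarrow> ('a \<Rightarrow> bool) \<Rightarrow> ('a \<Rightarrow> bool) \<Rightarrow> 'a"
  where "splitting \<kappa> x y = wo_rel.minim \<kappa> {i \<in> Field \<kappa>. x i \<noteq> y i}"

definition almost_regressive :: "'a rel \<Rightarrow> (('a \<Rightarrow> bool) set \<Rightarrow> 'a) \<Rightarrow> bool"
  where "almost_regressive \<kappa> c \<longleftrightarrow>
    (\<exists>\<mu> \<in> Field \<kappa>. \<forall>x \<in> cantor \<kappa>. \<forall>y \<in> cantor \<kappa>. x \<noteq> y \<longrightarrow>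
      (c {x, y}, wo_rel.max2 \<kappa> (splitting \<kappa> x y) \<mu>) \<in> \<kappa> - Id)"

definition c_monochromatic :: "('b set \<Rightarrow> 'a) \<Rightarrow> 'b set \<Rightarrow> bool"
  where "c_monochromatic c Y \<longleftrightarrow> c constant_on nsets Y 2"

end

theory Submission
  imports Defs
begin

text \<open>
  Borel sets have the Baire property with respect to \<open>\<kappa>\<close>-meagre sets.  Since there are fewer
  than \<open>\<kappa>\<close> possible values on the pairs splitting at a node \<open>s\<close>, some value \<open>i\<close> less than
  \<open>max (length s) \<mu>\<close> is taken, off a meagre set, on a product of cones \<open>N\<^sub>u \<times> N\<^sub>t\<close> with \<open>u\<close>, \<open>t\<close>
  extending the two successors of \<open>s\<close>.  A pressing down argument along a branch
  (this is where \<open>\<kappa>\<close> uncountable is used) shows that above some node a single \<open>i\<close> occurs at a dense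
  set of nodes.  Iterating \<open>s \<mapsto> t\<close> through such nodes gives a branch of length \<open>\<kappa>\<close> with side nodes
  \<open>u\<^sub>\<xi>\<close>, and a Baire category argument in the full support product of the cones of the \<open>u\<^sub>\<xi>\<close>
  picks points \<open>y\<^sub>\<xi>\<close> extending \<open>u\<^sub>\<xi>\<close> all of whose pairs have colour \<open>i\<close>.  Working in this product
  replaces the Kuratowski--Ulam theorem, which would need \<open>2\<^bsup><\<kappa>\<^esup> = \<kappa>\<close>.
\<close>

section \<open>The Baire property\<close>

text \<open>A witness that its union is \<kappa>-meagre. The closed sets themselves are kept, not
  only their union, so that later recursions can avoid them one at a time.\<close>

definition nowhere_dense_cover :: "'a rel \<Rightarrow> 'b topology \<Rightarrow> 'b set set \<Rightarrow> bool"
  where "nowhere_dense_cover \<kappa> X \<N> \<longleftrightarrow>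
    |\<N>| \<le>o \<kappa> \<and> (\<forall>N\<in>\<N>. closedin X N \<and> X interior_of N = {})"

definition baire_property :: "'a rel \<Rightarrow> 'b topology \<Rightarrow> 'b set \<Rightarrow> bool"
  where "baire_property \<kappa> X A \<longleftrightarrow>
    (\<exists>U \<N>. openin X U \<and> nowhere_dense_cover \<kappa> X \<N> \<and> A - U \<subseteq> \<Union>\<N> \<and> U - A \<subseteq> \<Union>\<N>)"

section \<open>Closure of the Baire property under the Borel operations\<close>

lemma nowhere_dense_cover_UN:
  assumes "Card_order \<kappa>" "infinite (Field \<kappa>)"
    and "\<And>i. i \<in> Field \<kappa> \<Longrightarrow> nowhere_dense_cover \<kappa> X (\<N> i)"
  shows "nowhere_dense_cover \<kappa> X (\<Union>i\<in>Field \<kappa>. \<N> i)"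
proof -
  have "|Field \<kappa>| \<le>o \<kappa>"
    by (simp add: assms(1) card_of_Field_ordIso ordIso_imp_ordLeq)
  then have "|\<Union>i\<in>Field \<kappa>. \<N> i| \<le>o \<kappa>"
    using assms unfolding nowhere_dense_cover_def
    by (intro card_of_UNION_ordLeq_infinite_Field) auto
  then show ?thesis
    using assms(3) unfolding nowhere_dense_cover_def by blast
qed

text \<open>The complement of the open set \<open>U\<close> differs from its interior
  \<open>?V\<close> only by the frontier of \<open>U\<close>, which is closed and nowhere dense; so
  one more set joins the cover.\<close>

lemma baire_property_compl:
  assumes "Card_order \<kappa>" "infinite (Field \<kappa>)" "baire_property \<kappa> X A"
  shows "baire_property \<kappa> X (topspace X - A)"
proof -
  obtain U \<N> where U: "openin X U" and N: "nowhere_dense_cover \<kappa> X \<N>"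
    and AU: "A - U \<subseteq> \<Union>\<N>" "U - A \<subseteq> \<Union>\<N>"
    using assms(3) unfolding baire_property_def by blast
  let ?V = "X interior_of (topspace X - U)"
  let ?F = "X frontier_of U"
  have F: "?F = topspace X - U - ?V"
    unfolding frontier_of_openin[OF U] interior_of_complement
    using closure_of_subset_topspace[of X U] by blast
  \<comment> \<open>A nonempty open subset of the frontier would meet \<open>U\<close>, since
    frontier points lie in the closure of \<open>U\<close>; but the frontier of an open set misses
    that set.\<close>
  have intF: "X interior_of ?F = {}"
  proof (rule ccontr)
    assume "X interior_of ?F \<noteq> {}"
    then have "X interior_of ?F \<inter> U \<noteq> {}"
      using interior_of_subset[of X ?F] frontier_of_openin_straddle_Int(1)[OF openin_interior_of, of X ?F U]
      by blast
    then show False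
      using F interior_of_subset[of X ?F] by blast
  qed
  have "|insert ?F \<N>| \<le>o \<kappa>"
  proof -
    have "|{?F}| \<le>o \<kappa>"
      using card_of_singl_ordLeq[OF infinite_imp_nonempty[OF assms(2)]] card_of_Field_ordIso[OF assms(1)]
      by (rule ordLeq_ordIso_trans)
    then have "|{?F} \<union> \<N>| \<le>o \<kappa>"
      using N assms(1,2) unfolding nowhere_dense_cover_def
      by (intro card_of_Un_ordLeq_infinite_Field) auto
    then show ?thesis by simp
  qed
  then have "nowhere_dense_cover \<kappa> X (insert ?F \<N>)"
    using N intF unfolding nowhere_dense_cover_def
    by (simp add: closedin_frontier_of)
  moreover have "(topspace X - A) - ?V \<subseteq> \<Union>(insert ?F \<N>)"
  proof
    fix x assume "x \<in> (topspace X - A) - ?V"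
    then have "x \<in> U - A \<or> x \<in> ?F"
      unfolding F by simp
    then show "x \<in> \<Union>(insert ?F \<N>)"
      using AU(2) by auto
  qed
  moreover have "?V - (topspace X - A) \<subseteq> \<Union>(insert ?F \<N>)"
  proof
    fix x assume "x \<in> ?V - (topspace X - A)"
    then have "x \<in> A - U"
      using interior_of_subset[of X "topspace X - U"] by auto
    then show "x \<in> \<Union>(insert ?F \<N>)"
      using AU(1) by auto
  qed
  ultimately show ?thesis
    unfolding baire_property_def using openin_interior_of[of X "topspace X - U"]
    by (intro exI[of _ ?V] exI[of _ "insert ?F \<N>"]) simp
qed

lemma baire_property_UN:
  assumes "Card_order \<kappa>" "infinite (Field \<kappa>)"
    and "\<And>i. i \<in> Field \<kappa> \<Longrightarrow> baire_property \<kappa> X (A i)"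
  shows "baire_property \<kappa> X (\<Union>i\<in>Field \<kappa>. A i)"
proof -
  define Q where "Q i U \<N> \<longleftrightarrow> openin X U \<and> nowhere_dense_cover \<kappa> X \<N>
      \<and> A i - U \<subseteq> \<Union>\<N> \<and> U - A i \<subseteq> \<Union>\<N>" for i U \<N>
  have "\<forall>i\<in>Field \<kappa>. \<exists>U \<N>. Q i U \<N>"
    using assms(3) unfolding baire_property_def Q_def by blast
  then obtain U \<N> where "\<And>i. i \<in> Field \<kappa> \<Longrightarrow> Q i (U i) (\<N> i)"
    by metis
  then have Q: "Q i (U i) (\<N> i)" if "i \<in> Field \<kappa>" for i
    using that by blast
  have UN: "openin X (U i)" "nowhere_dense_cover \<kappa> X (\<N> i)"
    "A i - U i \<subseteq> \<Union>(\<N> i)" "U i - A i \<subseteq> \<Union>(\<N> i)" if "i \<in> Field \<kappa>" for i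
    using Q[OF that] unfolding Q_def by blast+
  have "nowhere_dense_cover \<kappa> X (\<Union>i\<in>Field \<kappa>. \<N> i)"
    using assms(1,2) UN(2) by (rule nowhere_dense_cover_UN)
  moreover have "openin X (\<Union>i\<in>Field \<kappa>. U i)"
    using UN(1) by (intro openin_Union) auto
  moreover have "(\<Union>i\<in>Field \<kappa>. A i) - (\<Union>i\<in>Field \<kappa>. U i) \<subseteq> \<Union>(\<Union>i\<in>Field \<kappa>. \<N> i)"
    "(\<Union>i\<in>Field \<kappa>. U i) - (\<Union>i\<in>Field \<kappa>. A i) \<subseteq> \<Union>(\<Union>i\<in>Field \<kappa>. \<N> i)"
    using UN(3,4) by fastforce+
  ultimately show ?thesis
    unfolding baire_property_def by blast
qed

lemma kborel_subset_topspace: "A \<in> kborel \<kappa> X \<Longrightarrow> A \<subseteq> topspace X"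
  by (induction rule: kborel.induct) (auto dest: openin_subset)

lemma kborel_baire_property:
  assumes "Card_order \<kappa>" "infinite (Field \<kappa>)" "A \<in> kborel \<kappa> X"
  shows "baire_property \<kappa> X A"
  using assms(3)
proof (induction rule: kborel.induct)
  case (kborel_open U)
  have "nowhere_dense_cover \<kappa> X {}"
    using assms(1) by (simp add: nowhere_dense_cover_def card_of_empty1 card_order_on_well_order_on)
  then show ?case
    unfolding baire_property_def using kborel_open by blast
next
  case (kborel_compl A)
  then show ?case using assms baire_property_compl by blast
next
  case (kborel_Union F)
  then show ?case using assms baire_property_UN by blast
next
  case (kborel_Inter F)
  \<comment> \<open>Intersections reduce to complements and unions by De Morgan; the index set being
    nonempty keeps the intersection inside the space.\<close>
  have "baire_property \<kappa> X (topspace X - (\<Union>i\<in>Field \<kappa>. topspace X - F i))"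
    using kborel_Inter assms by (intro baire_property_compl baire_property_UN) auto
  moreover have "topspace X - (\<Union>i\<in>Field \<kappa>. topspace X - F i) = (\<Inter>i\<in>Field \<kappa>. F i)"
    using kborel_Inter.hyps(1) kborel_subset_topspace[OF kborel_Inter.hyps(2)] by auto
  ultimately show ?case by simp
qed

section \<open>Regular cardinals\<close>

locale uncountable_regular =
  fixes \<kappa> :: "'a rel"
  assumes Card: "Card_order \<kappa>" and unc: "natLeq <o \<kappa>" and reg: "regularCard \<kappa>"

sublocale uncountable_regular \<subseteq> wo_rel \<kappa>
  using Card by (simp add: wo_rel_def card_order_on_well_order_on)

context uncountable_regular
begin

section \<open>Order and boundedness below \<kappa>\<close>

lemma inf: "infinite (Field \<kappa>)"
proof
  assume "finite (Field \<kappa>)"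
  then have "|Field \<kappa>| <o natLeq"
    using finite_iff_ordLess_natLeq by blast
  then have "\<kappa> <o natLeq"
    using Card card_of_Field_ordIso ordIso_ordLess_trans ordIso_symmetric by blast
  then show False
    using unc not_ordLess_ordLeq ordLess_imp_ordLeq by blast
qed

lemma greater_exists: "a \<in> Field \<kappa> \<Longrightarrow> \<exists>b\<in>Field \<kappa>. a \<in> underS b"
  using infinite_Card_order_limit[OF Card inf] by (auto simp: underS_def)

lemma le_trans: "(a, b) \<in> \<kappa> \<Longrightarrow> (b, c) \<in> \<kappa> \<Longrightarrow> (a, c) \<in> \<kappa>"
  using TRANS by (meson transD)

lemma le_refl: "a \<in> Field \<kappa> \<Longrightarrow> (a, a) \<in> \<kappa>"
  using REFL by (simp add: refl_on_def)

lemma le_antisym: "(a, b) \<in> \<kappa> \<Longrightarrow> (b, a) \<in> \<kappa> \<Longrightarrow> a = b"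
  using ANTISYM by (meson antisymD)

lemma le_total: "a \<in> Field \<kappa> \<Longrightarrow> b \<in> Field \<kappa> \<Longrightarrow> (a, b) \<in> \<kappa> \<or> (b, a) \<in> \<kappa>"
  using TOTALS by blast

lemma le_Field: "(a, b) \<in> \<kappa> \<Longrightarrow> a \<in> Field \<kappa> \<and> b \<in> Field \<kappa>"
  by (auto simp: Field_def)

lemma underS_Field: "a \<in> underS b \<Longrightarrow> a \<in> Field \<kappa>"
  by (auto simp: underS_def Field_def)

lemma underS_le_trans: "a \<in> underS b \<Longrightarrow> (b, c) \<in> \<kappa> \<Longrightarrow> a \<in> underS c"
  using le_trans[of a b c] le_antisym[of a b] by (auto simp: underS_def)

lemma bounded:
  assumes "A \<subseteq> Field \<kappa>" "|A| <o \<kappa>"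
  shows "\<exists>b\<in>Field \<kappa>. \<forall>a\<in>A. (a, b) \<in> \<kappa>"
proof -
  \<comment> \<open>\<open>cofinal\<close> asks for strictly larger elements, so where it fails, at
    \<open>b\<close>, totality makes \<open>b\<close> an upper bound of \<open>A\<close>.\<close>
  have "\<not> cofinal A \<kappa>"
    using assms reg not_ordLess_ordIso unfolding regularCard_def by blast
  then obtain b where "b \<in> Field \<kappa>" "\<forall>a\<in>A. b = a \<or> (b, a) \<notin> \<kappa>"
    unfolding cofinal_def by blast
  then show ?thesis
    using assms(1) le_total le_refl by (metis subsetD)
qed

lemma bounded_image_underS:
  assumes "\<And>\<eta>. \<eta> \<in> underS \<xi> \<Longrightarrow> f \<eta> \<in> Field \<kappa>" "\<xi> \<in> Field \<kappa>"
  shows "\<exists>b\<in>Field \<kappa>. \<forall>\<eta>\<in>underS \<xi>. (f \<eta>, b) \<in> \<kappa>"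
proof -
  have "|f ` underS \<xi>| <o \<kappa>"
    using card_of_image card_of_underS[OF Card assms(2)] ordLeq_ordLess_trans by blast
  then show ?thesis
    using bounded[of "f ` underS \<xi>"] assms(1) by blast
qed

text \<open>Iterate \<omega> times a map \<open>g\<close> that goes strictly above its argument and
  bounds \<open>f\<close> below it, and take the supremum of the iterates. It stays below \<kappa>
  because \<kappa> is regular and uncountable.\<close>

lemma closure_point:
  assumes f: "\<And>\<xi>. \<xi> \<in> Field \<kappa> \<Longrightarrow> f \<xi> \<in> Field \<kappa>" and \<mu>: "\<mu> \<in> Field \<kappa>"
  shows "\<exists>\<delta>\<in>Field \<kappa>. \<mu> \<in> underS \<delta> \<and> (\<forall>\<xi>\<in>underS \<delta>. (f \<xi>, \<delta>) \<in> \<kappa>)"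
proof -
  have "\<exists>b\<in>Field \<kappa>. a \<in> underS b \<and> (\<forall>\<eta>\<in>underS a. (f \<eta>, b) \<in> \<kappa>)" if a: "a \<in> Field \<kappa>" for a
  proof -
    obtain b where b: "b \<in> Field \<kappa>" "\<forall>\<eta>\<in>underS a. (f \<eta>, b) \<in> \<kappa>"
      using bounded_image_underS[of a f] f underS_Field a by blast
    obtain d where d: "d \<in> Field \<kappa>" "a \<in> underS d"
      using greater_exists a by blast
    show ?thesis
      using b d le_total[of b d] le_trans underS_le_trans by blast
  qed
  then obtain g where g: "\<And>a. a \<in> Field \<kappa> \<Longrightarrow>
      g a \<in> Field \<kappa> \<and> a \<in> underS (g a) \<and> (\<forall>\<eta>\<in>underS a. (f \<eta>, g a) \<in> \<kappa>)"
    by metis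
  define d where "d n = (g ^^ n) \<mu>" for n
  have dF: "d n \<in> Field \<kappa>" for n
    by (induction n) (auto simp: d_def \<mu> g)
  have dS: "d (Suc n) = g (d n)" for n
    by (simp add: d_def)
  have "|range d| \<le>o |UNIV :: nat set|"
    by (rule card_of_image)
  then have "|range d| <o \<kappa>"
    using unc card_of_nat ordLeq_ordIso_trans ordLeq_ordLess_trans by blast
  then obtain b where b: "b \<in> Field \<kappa>" "\<forall>n. (d n, b) \<in> \<kappa>"
    using bounded[of "range d"] dF by blast
  let ?B = "{b \<in> Field \<kappa>. \<forall>n. (d n, b) \<in> \<kappa>}"
  define \<delta> where "\<delta> = minim ?B"
  have B: "?B \<subseteq> Field \<kappa>" "?B \<noteq> {}"
    using b by auto
  have \<delta>: "\<delta> \<in> Field \<kappa>" "\<And>n. (d n, \<delta>) \<in> \<kappa>"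
    using minim_in[OF B] by (auto simp: \<delta>_def)
  have "\<mu> \<in> underS \<delta>"
    using g[OF \<mu>] \<delta>(2)[of 1] underS_le_trans by (auto simp: d_def)
  \<comment> \<open>As \<open>\<delta>\<close> is the least upper bound of the iterates,
    \<open>\<xi>\<close> lies below some \<open>d n\<close>, and the next iterate bounds
    \<open>f \<xi>\<close>.\<close>
  moreover have "(f \<xi>, \<delta>) \<in> \<kappa>" if \<xi>: "\<xi> \<in> underS \<delta>" for \<xi>
  proof -
    have "\<xi> \<notin> ?B"
      using minim_least[OF B(1), of \<xi>] \<xi> le_antisym by (auto simp: \<delta>_def underS_def)
    then obtain n where "(d n, \<xi>) \<notin> \<kappa>"
      using \<xi> underS_Field by blast
    then have "\<xi> \<in> underS (d n)"
      using le_total[of \<xi> "d n"] dF \<xi> underS_Field le_refl by (auto simp: underS_def)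
    then have "(f \<xi>, d (Suc n)) \<in> \<kappa>"
      using g[OF dF] dS by metis
    then show ?thesis
      using \<delta>(2) le_trans by blast
  qed
  ultimately show ?thesis
    using \<delta>(1) by blast
qed

text \<open>Transfinite recursion of length \<kappa> through a preorder closed under shorter
  increasing sequences: stage \<open>\<xi>\<close> bounds all earlier values by some
  \<open>q\<close>, then meets the requirement \<open>D \<xi>\<close> above \<open>q\<close>. It is
  applied to single nodes and to \<kappa>-sequences of nodes.\<close>

lemma generic_chain:
  assumes trans: "\<And>p q r. le p q \<Longrightarrow> le q r \<Longrightarrow> le p r"
    and refl: "\<And>p. p \<in> P \<Longrightarrow> le p p"
    and ub: "\<And>\<xi> f. \<xi> \<in> Field \<kappa> \<Longrightarrow> (\<And>\<eta>. \<eta> \<in> underS \<xi> \<Longrightarrow> f \<eta> \<in> P)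
      \<Longrightarrow> (\<And>\<eta> \<zeta>. \<zeta> \<in> underS \<xi> \<Longrightarrow> (\<eta>, \<zeta>) \<in> \<kappa> \<Longrightarrow> le (f \<eta>) (f \<zeta>))
      \<Longrightarrow> \<exists>q\<in>P. \<forall>\<eta>\<in>underS \<xi>. le (f \<eta>) q"
    and dense: "\<And>\<xi> q. \<xi> \<in> Field \<kappa> \<Longrightarrow> q \<in> P \<Longrightarrow> \<exists>r\<in>P. le q r \<and> D \<xi> q r"
  obtains f where "\<And>\<xi>. \<xi> \<in> Field \<kappa> \<Longrightarrow> f \<xi> \<in> P"
    and "\<And>\<eta> \<xi>. (\<eta>, \<xi>) \<in> \<kappa> \<Longrightarrow> le (f \<eta>) (f \<xi>)"
    and "\<And>\<xi>. \<xi> \<in> Field \<kappa> \<Longrightarrow> \<exists>q\<in>P. (\<forall>\<eta>\<in>underS \<xi>. le (f \<eta>) q) \<and> le q (f \<xi>) \<and> D \<xi> q (f \<xi>)"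
proof -
  let ?Q = "\<lambda>f \<xi> r. \<xi> \<in> Field \<kappa> \<longrightarrow>
    r \<in> P \<and> (\<exists>q\<in>P. (\<forall>\<eta>\<in>underS \<xi>. le (f \<eta>) q) \<and> le q r \<and> D \<xi> q r)"
  have "\<exists>f. \<forall>\<xi>. ?Q f \<xi> (f \<xi>)"
  \<comment> \<open>The condition at \<open>\<xi>\<close> consults \<open>f\<close> only below
    \<open>\<xi>\<close>, as dependent choice along the well-order needs; outside
    \<open>Field \<kappa>\<close> it is vacuous.\<close>
  proof (rule dependent_wf_choice[OF WF])
    fix f g :: "'a \<Rightarrow> 'b" and x r
    assume "\<And>z. (z, x) \<in> \<kappa> - Id \<Longrightarrow> f z = g z"
    then have "\<forall>\<eta>\<in>underS x. f \<eta> = g \<eta>"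
      by (auto simp: underS_def)
    then show "?Q f x r = ?Q g x r"
      by auto
  next
    fix x f
    assume "\<And>y. (y, x) \<in> \<kappa> - Id \<Longrightarrow> ?Q f y (f y)"
    then have IH: "f y \<in> P" "\<exists>q\<in>P. (\<forall>\<eta>\<in>underS y. le (f \<eta>) q) \<and> le q (f y)"
      if "y \<in> underS x" for y
      using that underS_Field[OF that] by (auto simp: underS_def)
    \<comment> \<open>The bound chosen at \<open>\<zeta>\<close> lies between
      \<open>f \<eta>\<close> and \<open>f \<zeta>\<close>, so the part built so far is increasing,
      as \<open>ub\<close> demands.\<close>
    have mono: "le (f \<eta>) (f \<zeta>)" if "\<zeta> \<in> underS x" "(\<eta>, \<zeta>) \<in> \<kappa>" for \<eta> \<zeta>
      using IH[OF that(1)] trans refl that(2) by (cases "\<eta> = \<zeta>") (auto simp: underS_def)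
    show "\<exists>r. ?Q f x r"
    proof (cases "x \<in> Field \<kappa>")
      case True
      then obtain q where "q \<in> P" "\<forall>\<eta>\<in>underS x. le (f \<eta>) q"
        using ub[of x f] IH mono by blast
      then show ?thesis
        using dense[OF True] by blast
    qed auto
  qed
  then obtain f where f: "\<And>\<xi>. ?Q f \<xi> (f \<xi>)"
    by blast
  have "le (f \<eta>) (f \<xi>)" if "(\<eta>, \<xi>) \<in> \<kappa>" for \<eta> \<xi>
    using f[of \<xi>] trans refl that le_Field[OF that] by (cases "\<eta> = \<xi>") (auto simp: underS_def)
  with that f show ?thesis
    by blast
qed

section \<open>Conditions\<close>

text \<open>A pair \<open>(\<alpha>, x)\<close> represents the node \<open>x \<restriction> \<alpha>\<close> of the tree \<open>2\<^bsup><\<kappa>\<^esup>\<close>.\<close>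

definition Cond :: "('a \<times> ('a \<Rightarrow> bool)) set"
  where "Cond = Field \<kappa> \<times> cantor \<kappa>"

text \<open>End-extension of nodes. It is only a preorder: what \<open>snd p\<close> does from
  \<open>fst p\<close> on is irrelevant to the node.\<close>

definition ext :: "'a \<times> ('a \<Rightarrow> bool) \<Rightarrow> 'a \<times> ('a \<Rightarrow> bool) \<Rightarrow> bool"
  where "ext p q \<longleftrightarrow> (fst p, fst q) \<in> \<kappa> \<and> (\<forall>i\<in>underS (fst p). snd q i = snd p i)"

definition nbhd :: "'a \<times> ('a \<Rightarrow> bool) \<Rightarrow> ('a \<Rightarrow> bool) set"
  where "nbhd p = cone \<kappa> (fst p) (snd p)"

section \<open>Nodes, their cones and branches\<close>

lemma ext_refl: "p \<in> Cond \<Longrightarrow> ext p p"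
  using le_refl by (auto simp: ext_def Cond_def)

lemma ext_trans: "ext p q \<Longrightarrow> ext q r \<Longrightarrow> ext p r"
  unfolding ext_def using le_trans underS_le_trans by metis

lemma ext_nbhd: "ext p q \<Longrightarrow> nbhd q \<subseteq> nbhd p"
  unfolding ext_def nbhd_def cone_def using underS_le_trans by auto

lemma nbhd_self: "p \<in> Cond \<Longrightarrow> snd p \<in> nbhd p"
  by (auto simp: Cond_def nbhd_def cone_def)

lemma nbhd_cantor: "x \<in> nbhd p \<Longrightarrow> x \<in> cantor \<kappa>"
  by (auto simp: nbhd_def cone_def)

lemma ext_nbhd_point: "x \<in> nbhd p \<Longrightarrow> (fst p, \<alpha>) \<in> \<kappa> \<Longrightarrow> ext p (\<alpha>, x)"
  by (auto simp: ext_def nbhd_def cone_def)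

lemma chain_branch:
  assumes "\<And>p q. p \<in> C \<Longrightarrow> q \<in> C \<Longrightarrow> ext p q \<or> ext q p"
  shows "\<exists>x\<in>cantor \<kappa>. \<forall>p\<in>C. x \<in> nbhd p"
proof
  \<comment> \<open>The union of the nodes in \<open>C\<close>, completed by False where no node
    decides; comparability makes the value independent of the node consulted.\<close>
  define x where "x = (\<lambda>i\<in>Field \<kappa>. \<exists>p\<in>C. i \<in> underS (fst p) \<and> snd p i)"
  show x: "x \<in> cantor \<kappa>"
    by (simp add: x_def cantor_def)
  show "\<forall>p\<in>C. x \<in> nbhd p"
  proof
    fix p assume p: "p \<in> C"
    have "x i = snd p i" if i: "i \<in> underS (fst p)" for i
    proof -
      have "snd q i = snd p i" if "q \<in> C" "i \<in> underS (fst q)" for q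
        using assms[OF p that(1)] i that(2) by (auto simp: ext_def)
      then have "(\<exists>q\<in>C. i \<in> underS (fst q) \<and> snd q i) \<longleftrightarrow> snd p i"
        using i p by blast
      then show ?thesis
        using underS_Field[OF i] by (simp add: x_def)
    qed
    with x show "x \<in> nbhd p"
      by (auto simp: nbhd_def cone_def)
  qed
qed

text \<open>The union of the chain gives a branch \<open>x\<close>, and by regularity some length
  below \<kappa> bounds all lengths in the chain. The base node \<open>p\<close> is carried along so
  that the result extends \<open>p\<close> even when \<open>underS \<xi>\<close> is empty.\<close>

lemma ext_chain_ub:
  assumes \<xi>: "\<xi> \<in> Field \<kappa>" and p: "p \<in> Cond"
    and f: "\<And>\<eta>. \<eta> \<in> underS \<xi> \<Longrightarrow> f \<eta> \<in> Cond \<and> ext p (f \<eta>)"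
    and mono: "\<And>\<eta> \<zeta>. \<zeta> \<in> underS \<xi> \<Longrightarrow> (\<eta>, \<zeta>) \<in> \<kappa> \<Longrightarrow> ext (f \<eta>) (f \<zeta>)"
  shows "\<exists>q\<in>Cond. ext p q \<and> (\<forall>\<eta>\<in>underS \<xi>. ext (f \<eta>) q)"
proof -
  have "\<exists>x\<in>cantor \<kappa>. \<forall>q\<in>insert p (f ` underS \<xi>). x \<in> nbhd q"
  proof (rule chain_branch)
    fix q r assume "q \<in> insert p (f ` underS \<xi>)" "r \<in> insert p (f ` underS \<xi>)"
    then show "ext q r \<or> ext r q"
      using f mono p ext_refl le_total underS_Field by (smt (verit) image_iff insert_iff)
  qed
  then obtain x where x: "x \<in> cantor \<kappa>" "x \<in> nbhd p" "\<forall>\<eta>\<in>underS \<xi>. x \<in> nbhd (f \<eta>)"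
    by auto
  have f1: "fst (f \<eta>) \<in> Field \<kappa>" if "\<eta> \<in> underS \<xi>" for \<eta>
    using f[OF that] by (auto simp: Cond_def)
  obtain b where b: "b \<in> Field \<kappa>" "\<forall>\<eta>\<in>underS \<xi>. (fst (f \<eta>), b) \<in> \<kappa>"
    using bounded_image_underS[of \<xi> "\<lambda>\<eta>. fst (f \<eta>)", OF f1 \<xi>] by blast
  have p1: "fst p \<in> Field \<kappa>"
    using p by (auto simp: Cond_def)
  have "max2 (fst p) b \<in> Field \<kappa>" "(fst p, max2 (fst p) b) \<in> \<kappa>" "(b, max2 (fst p) b) \<in> \<kappa>"
    using p1 b(1) max2_greater le_Field by blast+
  moreover have "(fst (f \<eta>), max2 (fst p) b) \<in> \<kappa>" if "\<eta> \<in> underS \<xi>" for \<eta>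
    using b(2) that calculation(3) le_trans by blast
  ultimately show ?thesis
    using x by (intro bexI[of _ "(max2 (fst p) b, x)"]) (auto simp: Cond_def intro: ext_nbhd_point)
qed

section \<open>The topology on pairs\<close>

lemma openin_nbhd:
  assumes "p \<in> Cond"
  shows "openin (cantor_topology \<kappa>) (nbhd p)"
proof -
  have "nbhd p = cone \<kappa> (fst p) (restrict (snd p) (underS (fst p)))"
    by (auto simp: nbhd_def cone_def)
  moreover have "fst p \<in> Field \<kappa>" "restrict (snd p) (underS (fst p)) \<in> underS (fst p) \<rightarrow>\<^sub>E UNIV"
    using assms by (auto simp: Cond_def)
  ultimately show ?thesis
    unfolding cantor_topology_def by (intro topology_generated_by_Basis) blast
qed

text \<open>Cones form a base although they are only declared as generators: two cones around
  \<open>x\<close> are nested, so the longer one lies in their intersection.\<close>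

lemma openin_cantor_nbhd:
  assumes "openin (cantor_topology \<kappa>) U" "x \<in> U"
  shows "x \<in> cantor \<kappa> \<and> (\<exists>\<alpha>\<in>Field \<kappa>. nbhd (\<alpha>, x) \<subseteq> U)"
proof -
  have "generate_topology_on {cone \<kappa> \<alpha> s | \<alpha> s. \<alpha> \<in> Field \<kappa> \<and> s \<in> underS \<alpha> \<rightarrow>\<^sub>E UNIV} U"
    using assms(1) unfolding cantor_topology_def by (rule openin_topology_generated_by)
  then show ?thesis
    using assms(2)
  proof (induction rule: generate_topology_on.induct)
    case (Int a b)
    then obtain \<alpha> \<beta> where ab: "\<alpha> \<in> Field \<kappa>" "nbhd (\<alpha>, x) \<subseteq> a" "\<beta> \<in> Field \<kappa>" "nbhd (\<beta>, x) \<subseteq> b"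
      and x: "x \<in> cantor \<kappa>"
      by blast
    have "(\<alpha>, max2 \<alpha> \<beta>) \<in> \<kappa>" "(\<beta>, max2 \<alpha> \<beta>) \<in> \<kappa>"
      using ab max2_greater by blast+
    then have "ext (\<alpha>, x) (max2 \<alpha> \<beta>, x)" "ext (\<beta>, x) (max2 \<alpha> \<beta>, x)" "max2 \<alpha> \<beta> \<in> Field \<kappa>"
      using le_Field by (auto simp: ext_def)
    then show ?case
      using ab x ext_nbhd by blast
  next
    case (UN K)
    then show ?case by blast
  next
    case (Basis s)
    then obtain \<alpha> t where "s = cone \<kappa> \<alpha> t" "\<alpha> \<in> Field \<kappa>"
      by blast
    moreover from this Basis have "x \<in> cantor \<kappa>" "\<forall>i\<in>underS \<alpha>. x i = t i"
      by (simp_all add: cone_def)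
    then have "nbhd (\<alpha>, x) = cone \<kappa> \<alpha> t"
      by (simp add: nbhd_def cone_def)
    ultimately show ?case
      using \<open>x \<in> cantor \<kappa>\<close> by blast
  qed simp
qed

lemma topspace_cantor: "topspace (cantor_topology \<kappa>) = cantor \<kappa>"
proof
  show "topspace (cantor_topology \<kappa>) \<subseteq> cantor \<kappa>"
    using openin_cantor_nbhd openin_topspace by blast
  show "cantor \<kappa> \<subseteq> topspace (cantor_topology \<kappa>)"
  proof
    fix x assume "x \<in> cantor \<kappa>"
    moreover obtain \<alpha> where "\<alpha> \<in> Field \<kappa>"
      using inf by fastforce
    ultimately have "(\<alpha>, x) \<in> Cond"
      by (simp add: Cond_def)
    then show "x \<in> topspace (cantor_topology \<kappa>)"
      using openin_nbhd nbhd_self openin_subset by fastforce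
  qed
qed

section \<open>Boxes off the diagonal\<close>

lemma topspace_pair: "topspace (pair_topology \<kappa>) = (cantor \<kappa> \<times> cantor \<kappa>) \<inter> {(x, y). x \<noteq> y}"
  by (auto simp: pair_topology_def topspace_cantor)

lemma openin_pair_box:
  assumes "p \<in> Cond" "q \<in> Cond" "nbhd p \<inter> nbhd q = {}"
  shows "openin (pair_topology \<kappa>) (nbhd p \<times> nbhd q)"
proof -
  have "nbhd p \<times> nbhd q = (nbhd p \<times> nbhd q) \<inter> {(x, y). x \<noteq> y}"
    using assms(3) by auto
  moreover have "openin (prod_topology (cantor_topology \<kappa>) (cantor_topology \<kappa>)) (nbhd p \<times> nbhd q)"
    using assms openin_nbhd by (simp add: openin_prod_Times_iff)
  ultimately show ?thesis
    unfolding pair_topology_def openin_subtopology by blast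
qed

text \<open>One length \<open>\<gamma>\<close> serves both coordinates and exceeds prescribed
  lengths, so that the new nodes can extend given ones. The diagonal is removed explicitly, since
  \<open>x\<close> and \<open>y\<close> may agree below \<open>\<gamma>\<close>.\<close>

lemma openin_pair_nbhd:
  assumes "openin (pair_topology \<kappa>) U" "(x, y) \<in> U"
    and "\<alpha> \<in> Field \<kappa>" "\<beta> \<in> Field \<kappa>"
  shows "\<exists>\<gamma>. (\<alpha>, \<gamma>) \<in> \<kappa> \<and> (\<beta>, \<gamma>) \<in> \<kappa> \<and> (nbhd (\<gamma>, x) \<times> nbhd (\<gamma>, y)) \<inter> {(x, y). x \<noteq> y} \<subseteq> U"
proof -
  obtain T where T: "openin (prod_topology (cantor_topology \<kappa>) (cantor_topology \<kappa>)) T"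
    and U: "U = T \<inter> {(x, y). x \<noteq> y}"
    using assms(1) unfolding pair_topology_def openin_subtopology by blast
  have "(x, y) \<in> T"
    using assms(2) U by blast
  then have "\<exists>V W. openin (cantor_topology \<kappa>) V \<and> openin (cantor_topology \<kappa>) W \<and>
      x \<in> V \<and> y \<in> W \<and> V \<times> W \<subseteq> T"
    using T by (simp add: openin_prod_topology_alt)
  then obtain V W where "openin (cantor_topology \<kappa>) V" "openin (cantor_topology \<kappa>) W"
    "x \<in> V" "y \<in> W" and VW: "V \<times> W \<subseteq> T"
    by blast
  then obtain \<alpha>' \<beta>' where a: "\<alpha>' \<in> Field \<kappa>" "\<beta>' \<in> Field \<kappa>"
    and sub: "nbhd (\<alpha>', x) \<subseteq> V" "nbhd (\<beta>', y) \<subseteq> W"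
    using openin_cantor_nbhd by meson
  have "finite {\<alpha>, \<beta>, \<alpha>', \<beta>'}"
    by simp
  then have "|{\<alpha>, \<beta>, \<alpha>', \<beta>'}| <o \<kappa>"
    using finite_iff_ordLess_natLeq unc ordLess_transitive by blast
  then obtain \<gamma> where g: "(\<alpha>, \<gamma>) \<in> \<kappa>" "(\<beta>, \<gamma>) \<in> \<kappa>" "(\<alpha>', \<gamma>) \<in> \<kappa>" "(\<beta>', \<gamma>) \<in> \<kappa>"
    using bounded[of "{\<alpha>, \<beta>, \<alpha>', \<beta>'}"] assms(3,4) a by auto
  then have "nbhd (\<gamma>, x) \<subseteq> nbhd (\<alpha>', x)" "nbhd (\<gamma>, y) \<subseteq> nbhd (\<beta>', y)"
    by (auto intro!: ext_nbhd simp: ext_def)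
  then show ?thesis
    using g(1,2) sub VW U by blast
qed

text \<open>A set with empty interior cannot contain the nonempty open box of \<open>p\<close> and
  \<open>q\<close>, and as it is closed, some smaller box misses it. Disjointness of the cones keeps
  the boxes off the diagonal.\<close>

lemma avoid_nowhere_dense:
  assumes p: "p \<in> Cond" and q: "q \<in> Cond" and disj: "nbhd p \<inter> nbhd q = {}"
    and N: "closedin (pair_topology \<kappa>) N" "pair_topology \<kappa> interior_of N = {}"
  shows "\<exists>p'\<in>Cond. \<exists>q'\<in>Cond. ext p p' \<and> ext q q' \<and> (nbhd p' \<times> nbhd q') \<inter> N = {}"
proof -
  let ?W = "nbhd p \<times> nbhd q"
  have W: "openin (pair_topology \<kappa>) ?W"
    using openin_pair_box p q disj by blast
  have "\<not> ?W \<subseteq> N"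
    using interior_of_maximal[OF _ W, of N] N(2) nbhd_self[OF p] nbhd_self[OF q] by auto
  then obtain x y where xy: "x \<in> nbhd p" "y \<in> nbhd q" "(x, y) \<in> ?W - N"
    by blast
  have "openin (pair_topology \<kappa>) (?W - N)"
    using W N(1) by (rule openin_diff)
  then obtain \<gamma> where g: "(fst p, \<gamma>) \<in> \<kappa>" "(fst q, \<gamma>) \<in> \<kappa>"
    and sub: "(nbhd (\<gamma>, x) \<times> nbhd (\<gamma>, y)) \<inter> {(x, y). x \<noteq> y} \<subseteq> ?W - N"
    using openin_pair_nbhd[OF _ xy(3), of "fst p" "fst q"] p q by (auto simp: Cond_def)
  have e: "ext p (\<gamma>, x)" "ext q (\<gamma>, y)"
    using g xy ext_nbhd_point by blast+
  have "(nbhd (\<gamma>, x) \<times> nbhd (\<gamma>, y)) \<inter> N = {}"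
    using sub ext_nbhd[OF e(1)] ext_nbhd[OF e(2)] disj by blast
  moreover have "(\<gamma>, x) \<in> Cond" "(\<gamma>, y) \<in> Cond"
    using xy g le_Field nbhd_cantor by (auto simp: Cond_def)
  ultimately show ?thesis
    using e by blast
qed

text \<open>Baire category in the full support product of \<kappa> many cones. A requirement is a
  pair in \<open>R\<close> with a set in \<open>\<N>\<close>; it concerns two coordinates only, and
  there are at most \<kappa> requirements, so a recursion of length \<kappa> meets them all.\<close>

lemma generic_points:
  assumes u: "\<And>a. a \<in> Field \<kappa> \<Longrightarrow> u a \<in> Cond"
    and R: "\<And>a b. (a, b) \<in> R \<Longrightarrow> a \<in> Field \<kappa> \<and> b \<in> Field \<kappa> \<and> nbhd (u a) \<inter> nbhd (u b) = {}"
    and N: "nowhere_dense_cover \<kappa> (pair_topology \<kappa>) \<N>"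
  obtains y where "\<And>a. a \<in> Field \<kappa> \<Longrightarrow> y a \<in> nbhd (u a)"
    and "\<And>a b. (a, b) \<in> R \<Longrightarrow> (y a, y b) \<notin> \<Union>\<N>"
proof -
  define P where "P = {f. \<forall>a\<in>Field \<kappa>. f a \<in> Cond \<and> ext (u a) (f a)}"
  define le where "le f g \<longleftrightarrow> (\<forall>a\<in>Field \<kappa>. ext (f a) (g a))"
    for f g :: "'a \<Rightarrow> 'a \<times> ('a \<Rightarrow> bool)"
  have FF: "|Field \<kappa> \<times> Field \<kappa>| \<le>o \<kappa>"
    using Card_order_Times_same_infinite Card inf by blast
  have "R \<subseteq> Field \<kappa> \<times> Field \<kappa>"
    using R by auto
  then have "|R| \<le>o \<kappa>"
    using FF card_of_mono1 ordLeq_transitive by blast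
  then have "|R \<times> \<N>| \<le>o \<kappa>"
    using N Card inf unfolding nowhere_dense_cover_def
    by (intro card_of_Times_ordLeq_infinite_Field) auto
  then have RN: "|R \<times> \<N>| \<le>o |Field \<kappa>|"
    using Card card_of_Field_ordIso ordIso_symmetric ordLeq_ordIso_trans by blast
  \<comment> \<open>\<open>h\<close> lists the requirements along \<kappa>; if there are none, any
    \<open>h\<close> will do.\<close>
  have "\<exists>h. R \<times> \<N> \<subseteq> h ` Field \<kappa>"
  proof (cases "R \<times> \<N> = {}")
    case False
    have "\<exists>h. h ` Field \<kappa> = R \<times> \<N>"
      by (rule iffD2[OF card_of_ordLeq2[OF False] RN])
    then show ?thesis
      by (metis order_refl)
  qed auto
  then obtain h where h: "R \<times> \<N> \<subseteq> h ` Field \<kappa>"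
    by blast
  define D where "D \<xi> (q :: 'a \<Rightarrow> 'a \<times> ('a \<Rightarrow> bool)) r \<longleftrightarrow>
      (\<forall>a b N. (a, b) \<in> R \<longrightarrow> N \<in> \<N> \<longrightarrow> h \<xi> = ((a, b), N) \<longrightarrow> (nbhd (r a) \<times> nbhd (r b)) \<inter> N = {})"
    for \<xi> q r
  obtain f where f: "\<And>\<xi>. \<xi> \<in> Field \<kappa> \<Longrightarrow> f \<xi> \<in> P"
    "\<And>\<eta> \<xi>. (\<eta>, \<xi>) \<in> \<kappa> \<Longrightarrow> le (f \<eta>) (f \<xi>)"
    "\<And>\<xi>. \<xi> \<in> Field \<kappa> \<Longrightarrow> \<exists>q\<in>P. (\<forall>\<eta>\<in>underS \<xi>. le (f \<eta>) q) \<and> le q (f \<xi>) \<and> D \<xi> q (f \<xi>)"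
  proof (rule generic_chain[of le P D])
    show "le p r" if "le p q" "le q r" for p q r
      using that ext_trans unfolding le_def by blast
    show "le p p" if "p \<in> P" for p
      using that ext_refl unfolding le_def P_def by blast
  next
    fix \<xi> f
    assume \<xi>: "\<xi> \<in> Field \<kappa>" and fP: "\<And>\<eta>. \<eta> \<in> underS \<xi> \<Longrightarrow> f \<eta> \<in> P"
      and fm: "\<And>\<eta> \<zeta>. \<zeta> \<in> underS \<xi> \<Longrightarrow> (\<eta>, \<zeta>) \<in> \<kappa> \<Longrightarrow> le (f \<eta>) (f \<zeta>)"
    \<comment> \<open>Upper bounds are found in each coordinate separately and then chosen
      simultaneously, which full support permits.\<close>
    have "\<exists>q\<in>Cond. ext (u a) q \<and> (\<forall>\<eta>\<in>underS \<xi>. ext (f \<eta> a) q)" if a: "a \<in> Field \<kappa>" for a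
      using fP fm a unfolding P_def le_def by (intro ext_chain_ub[OF \<xi> u[OF a]]) auto
    then obtain q where "\<And>a. a \<in> Field \<kappa> \<Longrightarrow>
        q a \<in> Cond \<and> ext (u a) (q a) \<and> (\<forall>\<eta>\<in>underS \<xi>. ext (f \<eta> a) (q a))"
      by metis
    then show "\<exists>q\<in>P. \<forall>\<eta>\<in>underS \<xi>. le (f \<eta>) q"
      by (intro bexI[of _ q]) (auto simp: P_def le_def)
  next
    fix \<xi> q
    assume q: "q \<in> P"
    show "\<exists>r\<in>P. le q r \<and> D \<xi> q r"
    proof (cases "\<exists>a b N. (a, b) \<in> R \<and> N \<in> \<N> \<and> h \<xi> = ((a, b), N)")
      case True
      then obtain a b N where abN: "(a, b) \<in> R" "N \<in> \<N>" "h \<xi> = ((a, b), N)"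
        by blast
      have ab: "a \<in> Field \<kappa>" "b \<in> Field \<kappa>" "nbhd (u a) \<inter> nbhd (u b) = {}"
        using R abN(1) by auto
      have qab: "q a \<in> Cond" "q b \<in> Cond" "ext (u a) (q a)" "ext (u b) (q b)"
        using q ab unfolding P_def by auto
      then have disj: "nbhd (q a) \<inter> nbhd (q b) = {}"
        using ab(3) ext_nbhd by blast
      \<comment> \<open>A cone is nonempty, so it is not disjoint from itself. Hence the two updates
        below do not overwrite each other.\<close>
      then have "a \<noteq> b"
        using nbhd_self qab(1) by fastforce
      obtain p' q' where pq: "p' \<in> Cond" "q' \<in> Cond" "ext (q a) p'" "ext (q b) q'"
        "(nbhd p' \<times> nbhd q') \<inter> N = {}"
        using avoid_nowhere_dense[OF qab(1,2) disj] abN(2) N unfolding nowhere_dense_cover_def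
        by blast
      have "ext (u a) p'" "ext (u b) q'"
        using qab(3,4) pq(3,4) ext_trans by blast+
      then have "q(a := p', b := q') \<in> P"
        using q pq(1,2) unfolding P_def by simp
      moreover have "le q (q(a := p', b := q'))"
        using q pq ext_refl unfolding le_def P_def by auto
      moreover have "D \<xi> q (q(a := p', b := q'))"
        using pq(5) abN(3) \<open>a \<noteq> b\<close> unfolding D_def by auto
      ultimately show ?thesis by blast
    next
      case False
      then have "D \<xi> q q"
        unfolding D_def by blast
      moreover have "le q q"
        using q ext_refl unfolding le_def P_def by blast
      ultimately show ?thesis
        using q by blast
    qed
  qed blast
  \<comment> \<open>In each coordinate the nodes form a chain, and a branch through it is the point
    \<open>y a\<close>.\<close>
  have "\<exists>x\<in>cantor \<kappa>. \<forall>p\<in>(\<lambda>\<xi>. f \<xi> a) ` Field \<kappa>. x \<in> nbhd p" if "a \<in> Field \<kappa>" for a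
    using f(2) le_total that unfolding le_def by (intro chain_branch) blast
  then obtain y where y: "\<And>a \<xi>. a \<in> Field \<kappa> \<Longrightarrow> \<xi> \<in> Field \<kappa> \<Longrightarrow> y a \<in> nbhd (f \<xi> a)"
    by (metis imageI)
  show thesis
  proof
    show "y a \<in> nbhd (u a)" if a: "a \<in> Field \<kappa>" for a
      using f(1)[OF a] a y[OF a a] ext_nbhd unfolding P_def by blast
    show "(y a, y b) \<notin> \<Union>\<N>" if ab: "(a, b) \<in> R" for a b
    proof
      assume "(y a, y b) \<in> \<Union>\<N>"
      then obtain N where N: "N \<in> \<N>" "(y a, y b) \<in> N"
        by blast
      have "((a, b), N) \<in> h ` Field \<kappa>"
        using ab N(1) by (intro subsetD[OF h]) simp
      then obtain \<xi> where \<xi>: "\<xi> \<in> Field \<kappa>" "h \<xi> = ((a, b), N)"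
        by auto
      then have "(nbhd (f \<xi> a) \<times> nbhd (f \<xi> b)) \<inter> N = {}"
        using f(3)[OF \<xi>(1)] ab N(1) unfolding D_def by blast
      then show False
        using y R[OF ab] \<xi>(1) N(2) by blast
    qed
  qed
qed

end

section \<open>Homogeneous combs\<close>

locale regressive_colouring = uncountable_regular +
  fixes c :: "('a \<Rightarrow> bool) set \<Rightarrow> 'a" and \<mu> :: 'a
  assumes c_Field: "c \<in> nsets (cantor \<kappa>) 2 \<rightarrow> Field \<kappa>"
    and \<mu>: "\<mu> \<in> Field \<kappa>"
    and regressive: "\<And>x y. x \<in> cantor \<kappa> \<Longrightarrow> y \<in> cantor \<kappa> \<Longrightarrow> x \<noteq> y \<Longrightarrow>
      (c {x, y}, max2 (splitting \<kappa> x y) \<mu>) \<in> \<kappa> - Id"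
    and borel: "borel_colouring \<kappa> c"
begin

text \<open>Each colour class is Borel, hence open modulo a \<kappa>-meagre set. Uniting the
  \<kappa> many covers yields one exceptional family that is valid for all colours at once.\<close>

lemma colour_classes:
  "\<exists>U \<N>. nowhere_dense_cover \<kappa> (pair_topology \<kappa>) \<N> \<and>
    (\<forall>i\<in>Field \<kappa>. openin (pair_topology \<kappa>) (U i)) \<and>
    (\<forall>i\<in>Field \<kappa>. \<forall>x\<in>cantor \<kappa>. \<forall>y\<in>cantor \<kappa>. x \<noteq> y \<longrightarrow> (x, y) \<notin> \<Union>\<N> \<longrightarrow>
      (c {x, y} = i \<longleftrightarrow> (x, y) \<in> U i))"
proof -
  let ?B = "\<lambda>i. {(x, y) \<in> topspace (pair_topology \<kappa>). c {x, y} \<in> {i}}"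
  define Q where "Q i U \<N> \<longleftrightarrow> openin (pair_topology \<kappa>) U \<and>
      nowhere_dense_cover \<kappa> (pair_topology \<kappa>) \<N> \<and> ?B i - U \<subseteq> \<Union>\<N> \<and> U - ?B i \<subseteq> \<Union>\<N>" for i U \<N>
  have "baire_property \<kappa> (pair_topology \<kappa>) (?B i)" if "i \<in> Field \<kappa>" for i
    using borel that unfolding borel_colouring_def
    by (intro kborel_baire_property[OF Card inf]) auto
  then have ex: "\<forall>i\<in>Field \<kappa>. \<exists>U \<N>. Q i U \<N>"
    unfolding baire_property_def Q_def by blast
  obtain U \<N> where "\<And>i. i \<in> Field \<kappa> \<Longrightarrow> Q i (U i) (\<N> i)"
    using ex by metis
  then have Q: "Q i (U i) (\<N> i)" if "i \<in> Field \<kappa>" for i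
    using that by blast
  have UN: "openin (pair_topology \<kappa>) (U i)" "nowhere_dense_cover \<kappa> (pair_topology \<kappa>) (\<N> i)"
    "?B i - U i \<subseteq> \<Union>(\<N> i)" "U i - ?B i \<subseteq> \<Union>(\<N> i)" if "i \<in> Field \<kappa>" for i
    using Q[OF that] unfolding Q_def by blast+
  show ?thesis
  proof (intro exI conjI ballI impI)
    show "nowhere_dense_cover \<kappa> (pair_topology \<kappa>) (\<Union>i\<in>Field \<kappa>. \<N> i)"
      using Card inf UN(2) by (rule nowhere_dense_cover_UN)
    show "openin (pair_topology \<kappa>) (U i)" if "i \<in> Field \<kappa>" for i
      using UN(1) that by blast
    show "c {x, y} = i \<longleftrightarrow> (x, y) \<in> U i" if "i \<in> Field \<kappa>" "x \<in> cantor \<kappa>" "y \<in> cantor \<kappa>" "x \<noteq> y"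
      "(x, y) \<notin> \<Union>(\<Union>i\<in>Field \<kappa>. \<N> i)" for i x y
    proof -
      have "(x, y) \<in> ?B i \<longleftrightarrow> c {x, y} = i"
        using that by (auto simp: topspace_pair)
      then show ?thesis
        using UN(3,4)[OF that(1)] that(1,5) by blast
    qed
  qed
qed

text \<open>One step of a comb: from \<open>s\<close> the spine continues to \<open>t\<close>, the
  tooth is \<open>u\<close>, and \<open>i\<close> is the generic colour between them. Pairs are
  ordered tooth first, as the exceptional family need not be symmetric.\<close>

definition good :: "(('a \<Rightarrow> bool) \<times> ('a \<Rightarrow> bool)) set set \<Rightarrow> 'a \<times> ('a \<Rightarrow> bool) \<Rightarrow> 'a \<Rightarrow>
    'a \<times> ('a \<Rightarrow> bool) \<Rightarrow> 'a \<times> ('a \<Rightarrow> bool) \<Rightarrow> bool"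
  where "good \<N> s i t u \<longleftrightarrow> t \<in> Cond \<and> u \<in> Cond \<and> ext s t \<and> ext s u \<and> nbhd u \<inter> nbhd t = {} \<and>
    (i, max2 (fst s) \<mu>) \<in> \<kappa> - Id \<and>
    (\<forall>y\<in>nbhd u. \<forall>z\<in>nbhd t. (y, z) \<notin> \<Union>\<N> \<longrightarrow> c {y, z} = i)"

lemma splitting_eq:
  assumes "\<alpha> \<in> Field \<kappa>" "\<forall>i\<in>underS \<alpha>. x i = y i" "x \<alpha> \<noteq> y \<alpha>"
  shows "splitting \<kappa> x y = \<alpha>"
proof -
  let ?A = "{i \<in> Field \<kappa>. x i \<noteq> y i}"
  have A: "?A \<subseteq> Field \<kappa>" "\<alpha> \<in> ?A"
    using assms by auto
  have "minim ?A \<in> ?A" "(minim ?A, \<alpha>) \<in> \<kappa>"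
    using minim_in[of ?A] minim_least[of ?A \<alpha>] A by blast+
  then show ?thesis
    using assms(2) unfolding splitting_def underS_def by auto
qed

text \<open>Pick one pair outside the exceptional set whose points split exactly at the length of
  \<open>s\<close>. Its colour is bounded by regressivity, and since its class is open modulo the
  exceptional set, the colour persists on a small box around the pair.\<close>

lemma good_exists:
  obtains \<N> where "nowhere_dense_cover \<kappa> (pair_topology \<kappa>) \<N>"
    and "\<And>s. s \<in> Cond \<Longrightarrow> \<exists>i t u. good \<N> s i t u"
proof -
  obtain U \<N> where N: "nowhere_dense_cover \<kappa> (pair_topology \<kappa>) \<N>"
    and U: "\<forall>i\<in>Field \<kappa>. openin (pair_topology \<kappa>) (U i)"
    and "\<forall>i\<in>Field \<kappa>. \<forall>x\<in>cantor \<kappa>. \<forall>y\<in>cantor \<kappa>. x \<noteq> y \<longrightarrow> (x, y) \<notin> \<Union>\<N> \<longrightarrow>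
      (c {x, y} = i \<longleftrightarrow> (x, y) \<in> U i)"
    using colour_classes by (elim exE conjE)
  then have cU: "c {x, y} = i \<longleftrightarrow> (x, y) \<in> U i"
    if "i \<in> Field \<kappa>" "x \<in> cantor \<kappa>" "y \<in> cantor \<kappa>" "x \<noteq> y" "(x, y) \<notin> \<Union>\<N>" for i x y
    using that by simp
  have "\<exists>i t u. good \<N> s i t u" if s: "s \<in> Cond" for s
  proof -
    obtain \<alpha> x where sx: "s = (\<alpha>, x)" "\<alpha> \<in> Field \<kappa>" "x \<in> cantor \<kappa>"
      using s by (auto simp: Cond_def)
    obtain \<beta> where b: "\<beta> \<in> Field \<kappa>" "\<alpha> \<in> underS \<beta>"
      using greater_exists sx(2) by blast
    \<comment> \<open>The node of \<open>s\<close> with value \<open>v\<close> added at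
      \<open>\<alpha>\<close>; as \<open>\<beta>\<close> is strictly above \<open>\<alpha>\<close>,
      this value is part of the node.\<close>
    define p where "p v = (\<beta>, x(\<alpha> := v))" for v
    have pC: "p v \<in> Cond" for v
      using sx b(1) by (auto simp: p_def Cond_def cantor_def PiE_def extensional_def)
    have sp: "ext s (p v)" for v
      using b(2) by (auto simp: sx(1) p_def ext_def underS_def)
    have p\<alpha>: "y \<alpha> = v" if "y \<in> nbhd (p v)" for y v
      using that b(2) by (auto simp: p_def nbhd_def cone_def)
    have disj: "nbhd (p v) \<inter> nbhd (p w) = {}" if "v \<noteq> w" for v w
      using p\<alpha> that by blast
    obtain a where a: "a \<in> Field \<kappa>"
      using sx(2) by blast
    obtain b' where b': "b' \<in> Field \<kappa>" "a \<noteq> b'"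
      using greater_exists[OF a] by (auto simp: underS_def)
    \<comment> \<open>Only the two coordinates \<open>a\<close> and \<open>b'\<close> matter:
      \<open>b'\<close> carries \<open>p True\<close>, every other coordinate
      \<open>p False\<close>.\<close>
    obtain Y where Y: "\<And>d. d \<in> Field \<kappa> \<Longrightarrow> Y d \<in> nbhd (p (d = b'))"
      "\<And>d e. (d, e) \<in> {(a, b')} \<Longrightarrow> (Y d, Y e) \<notin> \<Union>\<N>"
    proof (rule generic_points[of "\<lambda>d. p (d = b')" "{(a, b')}" \<N>])
      fix d e assume "(d, e) \<in> {(a, b')}"
      then show "d \<in> Field \<kappa> \<and> e \<in> Field \<kappa> \<and> nbhd (p (d = b')) \<inter> nbhd (p (e = b')) = {}"
        using a b' disj[of False True] by simp
    qed (use pC N in blast)+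
    define y z where "y = Y a" and "z = Y b'"
    have yz: "y \<in> nbhd (p False)" "z \<in> nbhd (p True)" "(y, z) \<notin> \<Union>\<N>"
      using Y(1)[OF a] Y(1)[OF b'(1)] Y(2) b'(2) by (auto simp: y_def z_def)
    have yzc: "y \<in> cantor \<kappa>" "z \<in> cantor \<kappa>" "y \<noteq> z"
      using nbhd_cantor[OF yz(1)] nbhd_cantor[OF yz(2)] p\<alpha>[OF yz(1)] p\<alpha>[OF yz(2)] by auto
    define i where "i = c {y, z}"
    have "{y, z} \<in> nsets (cantor \<kappa>) 2"
      using yzc by (simp add: nsets_def)
    then have i: "i \<in> Field \<kappa>"
      using c_Field by (auto simp: i_def)
    have "y \<in> nbhd s" "z \<in> nbhd s"
      using yz ext_nbhd[OF sp] by blast+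
    then have "splitting \<kappa> y z = \<alpha>"
      using p\<alpha>[OF yz(1)] p\<alpha>[OF yz(2)] sx(2)
      by (intro splitting_eq) (auto simp: sx(1) nbhd_def cone_def)
    then have ireg: "(i, max2 (fst s) \<mu>) \<in> \<kappa> - Id"
      using regressive[OF yzc] by (simp add: i_def sx(1))
    have "(y, z) \<in> U i"
      using cU[OF i yzc yz(3)] by (simp add: i_def)
    \<comment> \<open>A length \<open>\<gamma>\<close> at least \<open>\<beta>\<close> makes the new
      nodes extend \<open>p False\<close> and \<open>p True\<close>, so their cones are disjoint and
      the box avoids the diagonal.\<close>
    from openin_pair_nbhd[OF bspec[OF U i] this b(1) b(1)] obtain \<gamma> where g: "(\<beta>, \<gamma>) \<in> \<kappa>"
      and sub: "(nbhd (\<gamma>, y) \<times> nbhd (\<gamma>, z)) \<inter> {(x, y). x \<noteq> y} \<subseteq> U i"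
      by (elim exE conjE)
    have C: "(\<gamma>, y) \<in> Cond" "(\<gamma>, z) \<in> Cond"
      using g le_Field yzc by (auto simp: Cond_def)
    have e: "ext (p False) (\<gamma>, y)" "ext (p True) (\<gamma>, z)"
      using g yz ext_nbhd_point[of _ "p _"] by (auto simp: p_def)
    have d: "nbhd (\<gamma>, y) \<inter> nbhd (\<gamma>, z) = {}"
      using ext_nbhd[OF e(1)] ext_nbhd[OF e(2)] disj[of False True] by blast
    have "c {y', z'} = i" if "y' \<in> nbhd (\<gamma>, y)" "z' \<in> nbhd (\<gamma>, z)" "(y', z') \<notin> \<Union>\<N>" for y' z'
    proof -
      have "y' \<noteq> z'"
        using that d by blast
      moreover from this have "(y', z') \<in> U i"
        using that by (intro subsetD[OF sub]) simp
      ultimately show ?thesis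
        using cU[OF i nbhd_cantor[OF that(1)] nbhd_cantor[OF that(2)]] that(3) by blast
    qed
    then have "good \<N> s i (\<gamma>, z) (\<gamma>, y)"
      unfolding good_def using C d ireg ext_trans[OF sp e(1)] ext_trans[OF sp e(2)] by blast
    then show ?thesis by blast
  qed
  with N that show thesis by blast
qed

text \<open>Pressing down: otherwise every colour can be excluded from some node on, and a chain is
  built whose stage \<open>\<xi>\<close> excludes the colour \<open>\<xi>\<close>. At a closure
  point \<open>\<delta>\<close> of the lengths, the branch cut at \<open>\<delta>\<close> has all
  colours below \<open>\<delta>\<close> excluded, yet its good colour must lie below
  \<open>\<delta>\<close>.\<close>

lemma dense_colour:
  assumes "\<And>s. s \<in> Cond \<Longrightarrow> \<exists>i t u. good \<N> s i t u"
  shows "\<exists>i. \<exists>r\<in>Cond. \<forall>s\<in>Cond. ext r s \<longrightarrow> (\<exists>s'\<in>Cond. ext s s' \<and> (\<exists>t u. good \<N> s' i t u))"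
proof (rule ccontr)
  define D where "D i q r \<longleftrightarrow> (\<forall>s\<in>Cond. ext r s \<longrightarrow> (\<forall>t u. \<not> good \<N> s i t u))"
    for i and q r :: "'a \<times> ('a \<Rightarrow> bool)"
  assume "\<not> ?thesis"
  then have dense: "\<exists>s\<in>Cond. ext r s \<and> D i q s" if "r \<in> Cond" for i q r
    using that unfolding D_def by meson
  \<comment> \<open>The root, that is the empty node; it serves as the base node when bounding
    chains.\<close>
  let ?r = "(minim (Field \<kappa>), restrict (\<lambda>_. False) (Field \<kappa>))"
  have r: "?r \<in> Cond" "\<And>p. p \<in> Cond \<Longrightarrow> ext ?r p"
  proof -
    have m: "minim (Field \<kappa>) \<in> Field \<kappa>"
      using minim_in[of "Field \<kappa>"] \<mu> by blast
    then show "?r \<in> Cond"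
      by (simp add: Cond_def cantor_def)
    have ml: "(minim (Field \<kappa>), a) \<in> \<kappa>" if "a \<in> Field \<kappa>" for a
      using minim_least[of "Field \<kappa>" a] that by blast
    then have "underS (minim (Field \<kappa>)) = {}"
      using underS_Field le_antisym by (fastforce simp: underS_def)
    then show "ext ?r p" if "p \<in> Cond" for p
      using that ml by (auto simp: Cond_def ext_def)
  qed
  obtain f where f: "\<And>\<xi>. \<xi> \<in> Field \<kappa> \<Longrightarrow> f \<xi> \<in> Cond"
    "\<And>\<eta> \<xi>. (\<eta>, \<xi>) \<in> \<kappa> \<Longrightarrow> ext (f \<eta>) (f \<xi>)"
    "\<And>\<xi>. \<xi> \<in> Field \<kappa> \<Longrightarrow> \<exists>q\<in>Cond. (\<forall>\<eta>\<in>underS \<xi>. ext (f \<eta>) q) \<and> ext q (f \<xi>) \<and> D \<xi> q (f \<xi>)"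
  proof (rule generic_chain[of ext Cond D])
    fix \<xi> f
    assume "\<xi> \<in> Field \<kappa>" "\<And>\<eta>. \<eta> \<in> underS \<xi> \<Longrightarrow> f \<eta> \<in> Cond"
      "\<And>\<eta> \<zeta>. \<zeta> \<in> underS \<xi> \<Longrightarrow> (\<eta>, \<zeta>) \<in> \<kappa> \<Longrightarrow> ext (f \<eta>) (f \<zeta>)"
    then show "\<exists>q\<in>Cond. \<forall>\<eta>\<in>underS \<xi>. ext (f \<eta>) q"
      using ext_chain_ub[of \<xi> ?r f] r by blast
  qed (use ext_trans ext_refl dense in blast)+
  obtain x where x: "x \<in> cantor \<kappa>" "\<And>\<xi>. \<xi> \<in> Field \<kappa> \<Longrightarrow> x \<in> nbhd (f \<xi>)"
    using chain_branch[of "f ` Field \<kappa>"] f(2) le_total by blast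
  have "fst (f \<xi>) \<in> Field \<kappa>" if "\<xi> \<in> Field \<kappa>" for \<xi>
    using f(1)[OF that] by (auto simp: Cond_def)
  \<comment> \<open>With \<open>\<mu>\<close> below \<open>\<delta>\<close>, the regressive bound at
    length \<open>\<delta>\<close> is \<open>\<delta>\<close> itself; and the stages before
    \<open>\<delta>\<close> have length at most \<open>\<delta>\<close>.\<close>
  then obtain \<delta> where \<delta>: "\<delta> \<in> Field \<kappa>" "\<mu> \<in> underS \<delta>" "\<forall>\<xi>\<in>underS \<delta>. (fst (f \<xi>), \<delta>) \<in> \<kappa>"
    using closure_point[of "\<lambda>\<xi>. fst (f \<xi>)"] \<mu> by blast
  have dx: "(\<delta>, x) \<in> Cond"
    using \<delta>(1) x(1) by (simp add: Cond_def)
  obtain i t u where gd: "good \<N> (\<delta>, x) i t u"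
    using assms[OF dx] by blast
  have "max2 \<delta> \<mu> = \<delta>"
    using \<delta>(2) le_antisym unfolding max2_def underS_def by auto
  then have i: "i \<in> underS \<delta>"
    using gd unfolding good_def underS_def by auto
  then have "ext (f i) (\<delta>, x)"
    using x(2) \<delta>(3) underS_Field ext_nbhd_point by blast
  then show False
    using f(3)[of i] underS_Field[OF i] gd dx unfolding D_def by blast
qed

text \<open>A comb of length \<kappa> is built above \<open>r\<close>, all of whose steps have
  colour \<open>i\<close>. A later tooth sits above the spine node \<open>t \<eta>\<close>, so
  against the tooth \<open>u \<eta>\<close> it falls under the same step; generic points of the
  teeth then realise the colour.\<close>

lemma monochromatic_family:
  "\<exists>i y. y ` Field \<kappa> \<subseteq> cantor \<kappa> \<and> inj_on y (Field \<kappa>) \<and>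
    (\<forall>\<xi>\<in>Field \<kappa>. \<forall>\<eta>\<in>underS \<xi>. c {y \<eta>, y \<xi>} = i)"
proof -
  obtain \<N> where N: "nowhere_dense_cover \<kappa> (pair_topology \<kappa>) \<N>"
    and gd: "\<And>s. s \<in> Cond \<Longrightarrow> \<exists>i t u. good \<N> s i t u"
    using good_exists by blast
  obtain i r where r: "r \<in> Cond"
    and dense: "\<And>s. s \<in> Cond \<Longrightarrow> ext r s \<Longrightarrow> \<exists>s'\<in>Cond. ext s s' \<and> (\<exists>t u. good \<N> s' i t u)"
    using dense_colour[OF gd] by blast
  \<comment> \<open>The recursion carries only the spine \<open>t\<close>; the splitting nodes
    \<open>s\<close> and the teeth \<open>u\<close> are hidden in the existential and chosen
    afterwards.\<close>
  define D where "D \<xi> q t \<longleftrightarrow> (\<exists>s u. ext q s \<and> good \<N> s i t u)"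
    for \<xi> :: 'a and q t
  obtain t where t: "\<And>\<xi>. \<xi> \<in> Field \<kappa> \<Longrightarrow> t \<xi> \<in> {p \<in> Cond. ext r p}"
    "\<And>\<eta> \<xi>. (\<eta>, \<xi>) \<in> \<kappa> \<Longrightarrow> ext (t \<eta>) (t \<xi>)"
    "\<And>\<xi>. \<xi> \<in> Field \<kappa> \<Longrightarrow> \<exists>q\<in>{p \<in> Cond. ext r p}.
      (\<forall>\<eta>\<in>underS \<xi>. ext (t \<eta>) q) \<and> ext q (t \<xi>) \<and> D \<xi> q (t \<xi>)"
  proof (rule generic_chain[of ext "{p \<in> Cond. ext r p}" D])
    fix \<xi> f
    assume "\<xi> \<in> Field \<kappa>" "\<And>\<eta>. \<eta> \<in> underS \<xi> \<Longrightarrow> f \<eta> \<in> {p \<in> Cond. ext r p}"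
      "\<And>\<eta> \<zeta>. \<zeta> \<in> underS \<xi> \<Longrightarrow> (\<eta>, \<zeta>) \<in> \<kappa> \<Longrightarrow> ext (f \<eta>) (f \<zeta>)"
    then show "\<exists>q\<in>{p \<in> Cond. ext r p}. \<forall>\<eta>\<in>underS \<xi>. ext (f \<eta>) q"
      using ext_chain_ub[of \<xi> r f] r by auto
  next
    fix \<xi> q
    assume "q \<in> {p \<in> Cond. ext r p}"
    then obtain s t u where "ext r q" "ext q s" "good \<N> s i t u"
      using dense by blast
    moreover from this have "ext s t" "t \<in> Cond"
      by (auto simp: good_def)
    ultimately show "\<exists>t\<in>{p \<in> Cond. ext r p}. ext q t \<and> D \<xi> q t"
      unfolding D_def using ext_trans by blast
  qed (use ext_trans ext_refl in blast)+
  have "\<exists>s u. (\<forall>\<eta>\<in>underS \<xi>. ext (t \<eta>) s) \<and> good \<N> s i (t \<xi>) u" if "\<xi> \<in> Field \<kappa>" for \<xi>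
    using t(3)[OF that] ext_trans unfolding D_def by blast
  then obtain s u where su: "\<And>\<xi>. \<xi> \<in> Field \<kappa> \<Longrightarrow>
      (\<forall>\<eta>\<in>underS \<xi>. ext (t \<eta>) (s \<xi>)) \<and> good \<N> (s \<xi>) i (t \<xi>) (u \<xi>)"
    by metis
  define R where "R = {(\<eta>, \<xi>). \<xi> \<in> Field \<kappa> \<and> \<eta> \<in> underS \<xi>}"
  \<comment> \<open>\<open>u \<xi>\<close> extends \<open>s \<xi>\<close>, which bounds all earlier
    spine nodes. With \<open>good\<close> at \<open>\<eta>\<close> this also makes the cones of
    distinct teeth disjoint.\<close>
  have sub: "nbhd (u \<xi>) \<subseteq> nbhd (t \<eta>)" if "\<xi> \<in> Field \<kappa>" "\<eta> \<in> underS \<xi>" for \<eta> \<xi>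
    using su[OF that(1)] that(2) ext_trans ext_nbhd unfolding good_def by blast
  obtain y where y: "\<And>\<xi>. \<xi> \<in> Field \<kappa> \<Longrightarrow> y \<xi> \<in> nbhd (u \<xi>)"
    "\<And>\<eta> \<xi>. (\<eta>, \<xi>) \<in> R \<Longrightarrow> (y \<eta>, y \<xi>) \<notin> \<Union>\<N>"
  proof (rule generic_points[of u R \<N>])
    show "u \<xi> \<in> Cond" if "\<xi> \<in> Field \<kappa>" for \<xi>
      using su[OF that] by (simp add: good_def)
    show "\<eta> \<in> Field \<kappa> \<and> \<xi> \<in> Field \<kappa> \<and> nbhd (u \<eta>) \<inter> nbhd (u \<xi>) = {}" if "(\<eta>, \<xi>) \<in> R" for \<eta> \<xi>
      using that sub[of \<xi> \<eta>] su[of \<eta>] underS_Field[of \<eta> \<xi>] unfolding R_def good_def by blast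
  qed (use N in blast)+
  have col: "c {y \<eta>, y \<xi>} = i" and neq: "y \<eta> \<noteq> y \<xi>" if "\<xi> \<in> Field \<kappa>" "\<eta> \<in> underS \<xi>" for \<eta> \<xi>
  proof -
    have F: "\<eta> \<in> Field \<kappa>"
      using that underS_Field by blast
    \<comment> \<open>The earlier point lies in the tooth at \<open>\<eta>\<close> and the later one
      above the spine at \<open>\<eta>\<close>, in the order in which \<open>good\<close> compares
      them.\<close>
    have "y \<eta> \<in> nbhd (u \<eta>)" "y \<xi> \<in> nbhd (t \<eta>)" "(y \<eta>, y \<xi>) \<notin> \<Union>\<N>"
      using y F that sub unfolding R_def by blast+
    moreover have "nbhd (u \<eta>) \<inter> nbhd (t \<eta>) = {}"
      "\<forall>y\<in>nbhd (u \<eta>). \<forall>z\<in>nbhd (t \<eta>). (y, z) \<notin> \<Union>\<N> \<longrightarrow> c {y, z} = i"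
      using su[OF F] unfolding good_def by simp_all
    ultimately show "c {y \<eta>, y \<xi>} = i" "y \<eta> \<noteq> y \<xi>"
      by (blast, metis disjoint_iff)
  qed
  show ?thesis
  proof (intro exI conjI ballI)
    show "y ` Field \<kappa> \<subseteq> cantor \<kappa>"
      using y(1) nbhd_cantor by blast
    show "inj_on y (Field \<kappa>)"
    proof (rule inj_onI, rule ccontr)
      fix a b assume ab: "a \<in> Field \<kappa>" "b \<in> Field \<kappa>" "y a = y b" "a \<noteq> b"
      then have "a \<in> underS b \<or> b \<in> underS a"
        using le_total by (auto simp: underS_def)
      then show False
        using neq[of a b] neq[of b a] ab by auto
    qed
  qed (rule col)
qed

end

theorem theorem2p12:
  fixes \<kappa> :: "'a rel" and c :: "('a \<Rightarrow> bool) set \<Rightarrow> 'a"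
  assumes "Card_order \<kappa>" and "natLeq <o \<kappa>" and "regularCard \<kappa>"
    and "c \<in> nsets (cantor \<kappa>) 2 \<rightarrow> Field \<kappa>"
    and "almost_regressive \<kappa> c"
    and "borel_colouring \<kappa> c"
  shows "\<exists>Y \<subseteq> cantor \<kappa>. |Y| =o \<kappa> \<and> c_monochromatic c Y"
proof -
  obtain \<mu> where "\<mu> \<in> Field \<kappa>" "\<And>x y. x \<in> cantor \<kappa> \<Longrightarrow> y \<in> cantor \<kappa> \<Longrightarrow> x \<noteq> y \<Longrightarrow>
      (c {x, y}, wo_rel.max2 \<kappa> (splitting \<kappa> x y) \<mu>) \<in> \<kappa> - Id"
    using assms(5) unfolding almost_regressive_def by blast
  then interpret regressive_colouring \<kappa> c \<mu>
    using assms by unfold_locales auto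
  obtain i y where y: "y ` Field \<kappa> \<subseteq> cantor \<kappa>" "inj_on y (Field \<kappa>)"
    and col: "\<forall>\<xi>\<in>Field \<kappa>. \<forall>\<eta>\<in>Order_Relation.underS \<kappa> \<xi>. c {y \<eta>, y \<xi>} = i"
    using monochromatic_family by blast
  let ?Y = "y ` Field \<kappa>"
  have "|Field \<kappa>| =o |?Y|"
    using y(2) card_of_ordIso inj_on_imp_bij_betw by blast
  then have "|?Y| =o \<kappa>"
    using card_of_Field_ordIso[OF Card] ordIso_symmetric ordIso_transitive by blast
  moreover have "c e = i" if e: "e \<in> nsets ?Y 2" for e
  proof -
    obtain a b where ab: "a \<in> Field \<kappa>" "b \<in> Field \<kappa>" "e = {y a, y b}" "a \<noteq> b"
      using e unfolding nsets_2_eq by blast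
    then have "a \<in> Order_Relation.underS \<kappa> b \<or> b \<in> Order_Relation.underS \<kappa> a"
      using le_total by (auto simp: underS_def)
    then show ?thesis
      using col ab by (metis insert_commute)
  qed
  ultimately show ?thesis
    using y(1) unfolding c_monochromatic_def constant_on_def by (intro exI[of _ ?Y] conjI) auto
qed

end
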